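(* Let $H$ be a Hilbert space, let $A$ be a linear, closed, densely defined operator in $H$ with null space $N:=N(A)$, let $f\in R(A)$ (so the equation $Au=f$ is solvable), and let $y$ be the minimal-norm solution of $Au=f$, i.e. the unique solution with $y\perp N$. Let $a>0$ be a constant, let $T=A^*A$, $T_a=T+aI$, $B=aT_a^{-1}$, and let $S$ denote the closure of the operator $T_a^{-1}A^*$ with domain $D(A^* )$. Let $u_1\in H$ be any element with $u_1\perp N$, and define $$u_{n+1}=Bu_n+Sf,\qquad n\ge 1.$$ Then $$\lim_{n\to\infty}\|u_n-y\|=0.$$
   Context: $D(\cdot)$, $R(\cdot)$ and $N(\cdot)$ denote domain, range and null space; "an operator in $H$" means a linear map $D(A)\subset H\to H$, possibly unbounded, not necessarily injective and with range not necessarily closed. $T=A^*A$ is the nonnegative selfadjoint operator with $D(T)=\{u\in D(A): Au\in D(A^* )\}$, and $I$ is the identity. The operator $T_a^{-1}A^*$, originally defined on $D(A^* )$, is closable and its closure $S$ is a bounded operator defined on all of $H$; thus $Sf$ makes sense for every $f\in H$. *)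

theory Defs
  imports "HOL-Analysis.Analysis"
begin

text \<open>
  The library only has real inner product spaces. To cover real and complex Hilbert spaces
  uniformly, the scalars range over the following class; by the axioms \<^prop>\<open>norm (x * y) = norm x * norm y\<close>
  of \<^class>\<open>real_normed_field\<close>, the reals and the complex numbers are up to isomorphism its only instances.
\<close>

class rclike = real_normed_field +
  fixes conj :: "'a \<Rightarrow> 'a"
    and re_part :: "'a \<Rightarrow> real"
  assumes conj_add: "conj (z + w) = conj z + conj w"
    and mult_conj: "z * conj z = (norm z)\<^sup>2 *\<^sub>R 1"
    and add_conj: "z + conj z = (2 * re_part z) *\<^sub>R 1"

instantiation real :: rclike
begin
definition conj_real :: "real \<Rightarrow> real" where "conj_real x = x"
definition re_part_real :: "real \<Rightarrow> real" where "re_part_real x = x"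
instance
  by standard (simp_all add: conj_real_def re_part_real_def power2_eq_square)
end

instantiation complex :: rclike
begin
definition conj_complex :: "complex \<Rightarrow> complex" where "conj_complex = cnj"
definition re_part_complex :: "complex \<Rightarrow> real" where "re_part_complex = Re"
instance
proof
  fix z w :: complex
  show "conj (z + w) = conj z + conj w"
    by (simp add: conj_complex_def)
  show "z * conj z = (norm z)\<^sup>2 *\<^sub>R 1"
    by (simp add: conj_complex_def complex_norm_square scaleR_conv_of_real del: complex_scaleR flip: of_real_power)
  show "z + conj z = (2 * re_part z) *\<^sub>R 1"
    by (simp add: conj_complex_def re_part_complex_def complex_eq_iff)
qed
end

text \<open>
  A Hilbert space over \<open>'k\<close>, with inner product \<open>ip\<close> linear in the first argument. Its norm, topology and
  completeness are those of the underlying real Hilbert space, which carries the inner product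
  \<^term>\<open>\<lambda>x y. re_part (ip x y)\<close>; in particular \<^term>\<open>(norm x)\<^sup>2\<close> is \<^term>\<open>ip x x\<close>.
\<close>

locale hilbert_space = vector_space smul
  for smul :: "'k::rclike \<Rightarrow> 'a::{real_inner,complete_space} \<Rightarrow> 'a" +
  fixes ip :: "'a \<Rightarrow> 'a \<Rightarrow> 'k"
  assumes scale_of_real: "smul (of_real r) x = r *\<^sub>R x"
    and ip_add_left: "ip (x + y) z = ip x z + ip y z"
    and ip_scale_left: "ip (smul c x) y = c * ip x y"
    and ip_commute: "ip y x = conj (ip x y)"
    and re_part_ip: "re_part (ip x y) = x \<bullet> y"

lemma hilbert_space_real:
  "hilbert_space (scaleR :: real \<Rightarrow> 'a::{real_inner,complete_space} \<Rightarrow> 'a) inner"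
  by unfold_locales
    (simp_all add: conj_real_def re_part_real_def inner_commute algebra_simps)

lemma hilbert_space_complex:
  "hilbert_space ((*) :: complex \<Rightarrow> complex \<Rightarrow> complex) (\<lambda>x y. x * cnj y)"
  by unfold_locales
    (simp_all add: conj_complex_def re_part_complex_def inner_complex_def scaleR_conv_of_real algebra_simps)

text \<open>
  A possibly unbounded operator is a domain together with a map, whose values outside the
  domain are irrelevant.
\<close>

datatype 'a operator = Operator (op_dom: "'a set") (op_app: "'a \<Rightarrow> 'a")

definition op_range :: "'a operator \<Rightarrow> 'a set" where
  "op_range A = op_app A ` op_dom A"

definition op_null :: "'a::zero operator \<Rightarrow> 'a set" where
  "op_null A = {u \<in> op_dom A. op_app A u = 0}"

definition op_graph :: "'a operator \<Rightarrow> ('a \<times> 'a) set" where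
  "op_graph A = {(u, op_app A u) |u. u \<in> op_dom A}"

definition linear_operator ::
    "('k::field \<Rightarrow> 'a::ab_group_add \<Rightarrow> 'a) \<Rightarrow> 'a operator \<Rightarrow> bool" where
  "linear_operator smul A \<longleftrightarrow>
     module.subspace smul (op_dom A) \<and>
     (\<forall>u\<in>op_dom A. \<forall>v\<in>op_dom A. op_app A (u + v) = op_app A u + op_app A v) \<and>
     (\<forall>c. \<forall>u\<in>op_dom A. op_app A (smul c u) = smul c (op_app A u))"

definition closed_operator :: "'a::topological_space operator \<Rightarrow> bool" where
  "closed_operator A \<longleftrightarrow> closed (op_graph A)"

definition densely_defined :: "'a::topological_space operator \<Rightarrow> bool" where
  "densely_defined A \<longleftrightarrow> closure (op_dom A) = UNIV"

definition orth_compl :: "('a \<Rightarrow> 'a \<Rightarrow> 'k::zero) \<Rightarrow> 'a set \<Rightarrow> 'a set" where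
  "orth_compl ip M = {u. \<forall>v\<in>M. ip u v = 0}"

text \<open>The value of the adjoint is uniquely determined if \<open>A\<close> is densely defined.\<close>

definition op_adjoint :: "('a \<Rightarrow> 'a \<Rightarrow> 'k) \<Rightarrow> 'a operator \<Rightarrow> 'a operator" where
  "op_adjoint ip A = Operator
     {v. \<exists>w. \<forall>u\<in>op_dom A. ip (op_app A u) v = ip u w}
     (\<lambda>v. THE w. \<forall>u\<in>op_dom A. ip (op_app A u) v = ip u w)"

definition op_id :: "'a operator" where
  "op_id = Operator UNIV (\<lambda>u. u)"

definition op_add :: "'a::plus operator \<Rightarrow> 'a operator \<Rightarrow> 'a operator" where
  "op_add A B = Operator (op_dom A \<inter> op_dom B) (\<lambda>u. op_app A u + op_app B u)"

definition op_scaleR :: "real \<Rightarrow> 'a::real_vector operator \<Rightarrow> 'a operator" where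
  "op_scaleR r A = Operator (op_dom A) (\<lambda>u. r *\<^sub>R op_app A u)"

definition op_comp :: "'a operator \<Rightarrow> 'a operator \<Rightarrow> 'a operator" where
  "op_comp A B = Operator {u \<in> op_dom B. op_app B u \<in> op_dom A} (\<lambda>u. op_app A (op_app B u))"

text \<open>Only meaningful for operators that are injective on their domain.\<close>

definition op_inverse :: "'a operator \<Rightarrow> 'a operator" where
  "op_inverse A = Operator (op_range A) (inv_into (op_dom A) (op_app A))"

text \<open>Only meaningful for closable operators, i.e. if the closure of the graph is single-valued.\<close>

definition op_closure :: "'a::topological_space operator \<Rightarrow> 'a operator" where
  "op_closure A = Operator
     {u. \<exists>w. (u, w) \<in> closure (op_graph A)}
     (\<lambda>u. THE w. (u, w) \<in> closure (op_graph A))"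

definition minimal_norm_solution :: "'a::real_normed_vector operator \<Rightarrow> 'a \<Rightarrow> 'a \<Rightarrow> bool" where
  "minimal_norm_solution A f y \<longleftrightarrow> is_arg_min norm (\<lambda>u. u \<in> op_dom A \<and> op_app A u = f) y"

lemma re_part_of_real: "re_part (of_real r :: 'k::rclike) = r"
proof (cases "r = 0")
  case True
  then show ?thesis
    using conj_add[of "0::'k" 0] add_conj[of "0::'k"] by simp
next
  case False
  have "of_real r * conj (of_real r :: 'k) = of_real r * of_real r"
    using mult_conj[of "of_real r :: 'k"] by (simp add: scaleR_conv_of_real power2_eq_square)
  with False have "conj (of_real r :: 'k) = of_real r" by simp
  with add_conj[of "of_real r :: 'k"] have "of_real (2 * r) = (of_real (2 * re_part (of_real r :: 'k)) :: 'k)"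
    by (simp add: scaleR_conv_of_real)
  then show ?thesis unfolding of_real_eq_iff by simp
qed

lemma re_part_zero: "re_part (0 :: 'k::rclike) = 0"
  using re_part_of_real[of 0, where 'k = 'k] by simp

text \<open>Minimal norm is the same as orthogonality to the null space, and such a solution is unique.\<close>

lemma minimal_norm_solution_iff:
  assumes "hilbert_space smul ip" "linear_operator smul A"
  shows "minimal_norm_solution A f y \<longleftrightarrow>
    y \<in> op_dom A \<and> op_app A y = f \<and> y \<in> orth_compl ip (op_null A)"
proof -
  interpret hilbert_space smul ip by fact
  have sub: "subspace (op_dom A)"
    and add: "\<And>u v. u \<in> op_dom A \<Longrightarrow> v \<in> op_dom A \<Longrightarrow> op_app A (u + v) = op_app A u + op_app A v"
    and smul: "\<And>c u. u \<in> op_dom A \<Longrightarrow> op_app A (smul c u) = smul c (op_app A u)"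
    using assms(2) by (auto simp: linear_operator_def)
  have scale_null: "smul c v \<in> op_null A" if "v \<in> op_null A" for c v
    using that sub by (auto simp: op_null_def smul subspace_scale)
  have shift: "u + v \<in> op_dom A \<and> op_app A (u + v) = op_app A u" if "u \<in> op_dom A" "v \<in> op_null A" for u v
    using that sub by (auto simp: op_null_def add subspace_add)
  show ?thesis
  proof (intro iffI conjI)
    assume min: "minimal_norm_solution A f y"
    then show y: "y \<in> op_dom A" "op_app A y = f"
      by (auto simp: minimal_norm_solution_def is_arg_min_def)
    have inner0: "y \<bullet> v = 0" if v: "v \<in> op_null A" for v
    proof (cases "v = 0")
      case False
      define t where "t = - (y \<bullet> v) / (v \<bullet> v)"
      have "t *\<^sub>R v \<in> op_null A"
        using scale_null[OF v, of "of_real t"] by (simp add: scale_of_real)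
      with min shift[OF y(1)] y have "norm y \<le> norm (y + t *\<^sub>R v)"
        by (force simp: minimal_norm_solution_def is_arg_min_def)
      then have "y \<bullet> y \<le> (y + t *\<^sub>R v) \<bullet> (y + t *\<^sub>R v)"
        by (simp add: norm_le)
      then have "0 \<le> 2 * t * (y \<bullet> v) + t * t * (v \<bullet> v)"
        by (simp add: inner_add_left inner_add_right inner_commute algebra_simps)
      also have "\<dots> = - ((y \<bullet> v)\<^sup>2 / (v \<bullet> v))"
        using False by (simp add: t_def field_simps power2_eq_square)
      finally have "(y \<bullet> v)\<^sup>2 / (v \<bullet> v) \<le> 0" by simp
      moreover have "v \<bullet> v > 0" using False by simp
      ultimately show ?thesis
        by (simp add: divide_le_0_iff)
    qed simp
    have "ip y v = 0" if "v \<in> op_null A" for v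
    proof -
      define c where "c = ip y v"
      have "ip (smul c v) y = of_real ((norm c)\<^sup>2)"
        unfolding ip_scale_left ip_commute[of v y] c_def mult_conj by (simp add: scaleR_conv_of_real)
      then have "(norm c)\<^sup>2 = smul c v \<bullet> y"
        unfolding re_part_ip[symmetric] by (simp only: re_part_of_real)
      also have "\<dots> = 0"
        using inner0[OF scale_null[OF that]] by (simp add: inner_commute)
      finally show ?thesis by (simp add: c_def)
    qed
    then show "y \<in> orth_compl ip (op_null A)" by (simp add: orth_compl_def)
  next
    assume *: "y \<in> op_dom A \<and> op_app A y = f \<and> y \<in> orth_compl ip (op_null A)"
    have "norm y \<le> norm z" if z: "z \<in> op_dom A" "op_app A z = f" for z
    proof -
      have "y + (z - y) \<in> op_dom A" "z - y \<in> op_dom A"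
        using z * sub by (auto simp: subspace_diff)
      then have "z - y \<in> op_null A"
        using add[of y "z - y"] * z by (simp add: op_null_def)
      then have "ip y (z - y) = 0" using * by (auto simp: orth_compl_def)
      then have "y \<bullet> (z - y) = 0"
        by (simp add: re_part_zero flip: re_part_ip)
      then have "y \<bullet> y = y \<bullet> z" by (simp add: inner_diff_right)
      then have "norm y * norm y \<le> norm y * norm z"
        using norm_cauchy_schwarz[of y z] by (simp add: power2_norm_eq_inner power2_eq_square flip: power2_norm_eq_inner)
      then show ?thesis by (cases "y = 0") (simp_all)
    qed
    with * show "minimal_norm_solution A f y"
      by (force simp: minimal_norm_solution_def is_arg_min_def)
  qed
qed

lemma minimal_norm_solution_unique:
  assumes "hilbert_space smul ip" "linear_operator smul A"
    and y: "minimal_norm_solution A f y" and z: "minimal_norm_solution A f z"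
  shows "y = z"
proof -
  interpret hilbert_space smul ip by fact
  have y': "y \<in> op_dom A" "op_app A y = f" "y \<in> orth_compl ip (op_null A)"
    and z': "z \<in> op_dom A" "op_app A z = f" "z \<in> orth_compl ip (op_null A)"
    using y z minimal_norm_solution_iff[OF assms(1,2)] by auto
  have dom: "y - z \<in> op_dom A"
    using assms(2) y' z' by (auto simp: linear_operator_def subspace_diff)
  then have "op_app A (z + (y - z)) = op_app A z + op_app A (y - z)"
    using assms(2) z' unfolding linear_operator_def by blast
  with dom have null: "y - z \<in> op_null A" using y' z' by (simp add: op_null_def)
  have "(y - z) \<bullet> (y - z) = y \<bullet> (y - z) - z \<bullet> (y - z)"
    by (simp add: inner_diff_left)
  also have "\<dots> = re_part (ip y (y - z)) - re_part (ip z (y - z))"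
    by (simp only: re_part_ip)
  also have "\<dots> = 0" using null y' z' by (simp add: orth_compl_def)
  finally show ?thesis by simp
qed

end

theory Submission
  imports Defs
begin

text \<open>
  Since \<open>S f = y - B y\<close>, the errors \<open>e\<^sub>n = u\<^sub>n - y\<close> satisfy \<open>e\<^sub>n\<^sub>+\<^sub>1 = B e\<^sub>n\<close>. No spectral theorem is needed:
  \<open>B\<close> is selfadjoint with \<open>0 \<le> B\<^sup>2 \<le> B \<le> I\<close>, so \<open>\<langle>e\<^sub>m, e\<^sub>n\<rangle>\<close> depends only on \<open>m + n\<close> and decreases in it.
  Hence \<open>\<parallel>e\<^sub>m - e\<^sub>n\<parallel>\<^sup>2\<close> is small for large \<open>m, n\<close> and \<open>e\<^sub>n\<close> converges to a fixed point of \<open>B\<close>,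
  i.e. to an element of \<open>N(A)\<close>; as \<open>e\<^sub>n \<bottom> N(A)\<close>, the limit is 0.
\<close>

section \<open>Orthogonal projections and density in real Hilbert spaces\<close>

text \<open>By the parallelogram identity a minimizing sequence for the distance to \<open>M\<close>
  is Cauchy: the midpoint of two of its terms lies in \<open>M\<close> again. The minimizer
  \<open>q\<close> has a residual orthogonal to \<open>M\<close>.\<close>

lemma exists_orthogonal_projection:
  fixes M :: "'a::{real_inner,complete_space} set"
  assumes "closed M" "subspace M"
  obtains p where "p \<in> M" "\<And>v. v \<in> M \<Longrightarrow> (x - p) \<bullet> v = 0"
proof -
  let ?Q = "(\<lambda>v. (norm (x - v))\<^sup>2) ` M"
  define d where "d = Inf ?Q"
  have "M \<noteq> {}" using assms(2) subspace_0 by blast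
  have bdd: "bdd_below ?Q" by (rule bdd_belowI[of _ 0]) auto
  have d_le: "d \<le> (norm (x - v))\<^sup>2" if "v \<in> M" for v
    unfolding d_def using bdd that by (intro cInf_lower) auto
  have "\<exists>v\<in>M. (norm (x - v))\<^sup>2 < d + inverse (real (Suc n))" for n
  proof -
    have "Inf ?Q < d + inverse (real (Suc n))" unfolding d_def by simp
    then show ?thesis using cInf_lessD[of ?Q] \<open>M \<noteq> {}\<close> by blast
  qed
  then obtain p where pM: "\<And>n. p n \<in> M"
    and p_lt: "\<And>n. (norm (x - p n))\<^sup>2 < d + inverse (real (Suc n))" by metis
  have diff: "(norm (p m - p n))\<^sup>2 \<le> 2 * inverse (real (Suc m)) + 2 * inverse (real (Suc n))" for m n
  proof -
    have "(1/2) *\<^sub>R (p m + p n) \<in> M"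
      using assms(2) pM by (intro subspace_scale subspace_add) auto
    then have "d \<le> (norm (x - (1/2) *\<^sub>R (p m + p n)))\<^sup>2" by (rule d_le)
    moreover have "(norm (p m - p n))\<^sup>2 = 2 * (norm (x - p m))\<^sup>2 + 2 * (norm (x - p n))\<^sup>2
        - 4 * (norm (x - (1/2) *\<^sub>R (p m + p n)))\<^sup>2"
      by (simp add: power2_norm_eq_inner inner_diff_left inner_diff_right inner_add_left
          inner_add_right inner_commute algebra_simps)
    ultimately show ?thesis using p_lt[of m] p_lt[of n] by linarith
  qed
  have "Cauchy p"
  proof (rule metric_CauchyI)
    fix e :: real assume "0 < e"
    then obtain N where N: "inverse (real (Suc N)) < e\<^sup>2 / 4"
      using reals_Archimedean[of "e\<^sup>2 / 4"] by auto
    have "dist (p m) (p n) < e" if "m \<ge> N" "n \<ge> N" for m n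
    proof -
      have "inverse (real (Suc m)) \<le> inverse (real (Suc N))"
        "inverse (real (Suc n)) \<le> inverse (real (Suc N))" using that by (auto intro!: le_imp_inverse_le)
      then have "(norm (p m - p n))\<^sup>2 < e\<^sup>2" using diff[of m n] N by linarith
      then show ?thesis using \<open>0 < e\<close> by (simp add: dist_norm power2_less_imp_less)
    qed
    then show "\<exists>N. \<forall>m\<ge>N. \<forall>n\<ge>N. dist (p m) (p n) < e" by blast
  qed
  then obtain q where q: "p \<longlonglongrightarrow> q" by (auto simp: Cauchy_convergent_iff convergent_def)
  have qM: "q \<in> M" using closed_sequentially[OF assms(1)] pM q by blast
  have "(norm (x - q))\<^sup>2 \<le> d"
  proof (rule LIMSEQ_le)
    show "(\<lambda>n. (norm (x - p n))\<^sup>2) \<longlonglongrightarrow> (norm (x - q))\<^sup>2" by (intro tendsto_intros q)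
    show "(\<lambda>n. d + inverse (real (Suc n))) \<longlonglongrightarrow> d"
      using tendsto_add[OF tendsto_const LIMSEQ_inverse_real_of_nat, of d] by simp
    show "\<exists>N. \<forall>n\<ge>N. (norm (x - p n))\<^sup>2 \<le> d + inverse (real (Suc n))"
      using p_lt less_imp_le by blast
  qed
  then have q_min: "(norm (x - q))\<^sup>2 \<le> (norm (x - v))\<^sup>2" if "v \<in> M" for v
    using d_le[OF that] by linarith
  have "(x - q) \<bullet> v = 0" if "v \<in> M" for v
  proof (cases "v = 0")
    case False
    \<comment> \<open>This \<open>t\<close> minimizes the quadratic
      \<open>||x - q - t v||^2\<close>. Since \<open>t = 0\<close> is also optimal, the decrease it
      yields must vanish.\<close>
    define t where "t = ((x - q) \<bullet> v) / (v \<bullet> v)"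
    have "q + t *\<^sub>R v \<in> M" using assms(2) qM that by (intro subspace_add subspace_scale) auto
    from q_min[OF this] have "0 \<le> - 2 * t * ((x - q) \<bullet> v) + t * t * (v \<bullet> v)"
      by (simp add: power2_norm_eq_inner inner_diff_left inner_diff_right inner_add_left
          inner_add_right inner_commute algebra_simps)
    also have "\<dots> = - (((x - q) \<bullet> v)\<^sup>2 / (v \<bullet> v))"
      using False by (simp add: t_def field_simps power2_eq_square)
    finally have "((x - q) \<bullet> v)\<^sup>2 / (v \<bullet> v) \<le> 0" by simp
    moreover have "v \<bullet> v > 0" using False by simp
    ultimately show ?thesis by (simp add: divide_le_0_iff)
  qed simp
  with qM that show thesis by blast
qed

lemma subspace_closure:
  fixes M :: "'a::real_normed_vector set"
  assumes "subspace M"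
  shows "subspace (closure M)"
proof (rule subspaceI)
  show "0 \<in> closure M" using subspace_0[OF assms] closure_subset by blast
next
  fix x y assume "x \<in> closure M" "y \<in> closure M"
  then obtain p q where "\<forall>n. p n \<in> M" "p \<longlonglongrightarrow> x" "\<forall>n. q n \<in> M" "q \<longlonglongrightarrow> y"
    unfolding closure_sequential by blast
  then show "x + y \<in> closure M"
    unfolding closure_sequential using assms
    by (intro exI[of _ "\<lambda>n. p n + q n"]) (auto intro!: tendsto_add subspace_add)
next
  fix c x assume "x \<in> closure M"
  then obtain p where "\<forall>n. p n \<in> M" "p \<longlonglongrightarrow> x"
    unfolding closure_sequential by blast
  then show "c *\<^sub>R x \<in> closure M"
    unfolding closure_sequential using assms
    by (intro exI[of _ "\<lambda>n. c *\<^sub>R p n"]) (auto intro!: tendsto_scaleR subspace_scale)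
qed

text \<open>The residual of the projection onto the closure of \<open>M\<close> is orthogonal to
  \<open>M\<close>, hence 0.\<close>

lemma dense_subspace_if_orthogonal_trivial:
  fixes M :: "'a::{real_inner,complete_space} set"
  assumes "subspace M" and triv: "\<And>x. (\<And>v. v \<in> M \<Longrightarrow> x \<bullet> v = 0) \<Longrightarrow> x = 0"
  shows "closure M = UNIV"
proof -
  have "x \<in> closure M" for x
  proof -
    obtain p where p: "p \<in> closure M" "\<And>v. v \<in> closure M \<Longrightarrow> (x - p) \<bullet> v = 0"
      using exists_orthogonal_projection[of "closure M" x] assms(1) subspace_closure by blast
    then have "x - p = 0" using triv[of "x - p"] closure_subset by blast
    then show ?thesis using p(1) by simp
  qed
  then show ?thesis by blast
qed

section \<open>Closed densely defined operators over the reals\<close>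

text \<open>Scalars are real here: a \<open>'k\<close>-linear operator is also real linear, and its
  adjoint is the same for \<open>ip\<close> and for the real inner product, so the theorem reduces
  to this setting.\<close>

locale closed_dense_operator =
  fixes A :: "'a::{real_inner,complete_space} operator"
  assumes lin: "linear_operator scaleR A"
    and cl: "closed_operator A"
    and dense: "densely_defined A"
begin

lemma subspace_dom: "subspace (op_dom A)"
  using lin by (simp add: linear_operator_def subspace_raw_def)

lemma app_add: "u \<in> op_dom A \<Longrightarrow> v \<in> op_dom A \<Longrightarrow> op_app A (u + v) = op_app A u + op_app A v"
  using lin by (simp add: linear_operator_def)

lemma app_scale: "u \<in> op_dom A \<Longrightarrow> op_app A (c *\<^sub>R u) = c *\<^sub>R op_app A u"
  using lin by (simp add: linear_operator_def)

lemma app_diff: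
  assumes "u \<in> op_dom A" "v \<in> op_dom A"
  shows "op_app A (u - v) = op_app A u - op_app A v"
proof -
  have "op_app A ((u - v) + v) = op_app A (u - v) + op_app A v"
    using assms subspace_dom by (intro app_add subspace_diff)
  then show ?thesis by (simp add: algebra_simps)
qed

lemma app_zero: "op_app A 0 = 0"
  using app_scale[of 0 0] subspace_0[OF subspace_dom] by simp

lemma orthogonal_dom_eq_0:
  assumes "\<And>v. v \<in> op_dom A \<Longrightarrow> v \<bullet> x = 0"
  shows "x = 0"
proof -
  have "closed {v. v \<bullet> x = 0}" by (intro closed_Collect_eq continuous_intros)
  then have "closure (op_dom A) \<subseteq> {v. v \<bullet> x = 0}" using assms by (intro closure_minimal) auto
  then have "x \<bullet> x = 0" using dense unfolding densely_defined_def by blast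
  then show ?thesis by simp
qed

section \<open>The weak normal equation: a priori bounds, uniqueness, existence\<close>

text \<open>
  The weak form of \<open>A\<^sup>*(A w - g) + a w = h\<close>. Both operators of the iteration are given by it:
  \<open>w = B x\<close> for \<open>h = a x\<close>, \<open>g = 0\<close>, and \<open>w = S g\<close> for \<open>h = 0\<close> and arbitrary \<open>g\<close>.
\<close>

definition normal_eq :: "real \<Rightarrow> 'a \<Rightarrow> 'a \<Rightarrow> 'a \<Rightarrow> bool" where
  "normal_eq a h g w \<longleftrightarrow> w \<in> op_dom A \<and>
     (\<forall>v\<in>op_dom A. op_app A v \<bullet> (op_app A w - g) = v \<bullet> (h - a *\<^sub>R w))"

lemma normal_eq_diff:
  assumes "normal_eq a h g w" "normal_eq a h' g' w'"
  shows "normal_eq a (h - h') (g - g') (w - w')"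
proof -
  have "w - w' \<in> op_dom A" using assms subspace_dom by (auto simp: normal_eq_def subspace_diff)
  moreover have "op_app A v \<bullet> (op_app A (w - w') - (g - g')) = v \<bullet> (h - h' - a *\<^sub>R (w - w'))"
    if "v \<in> op_dom A" for v
  proof -
    have "op_app A v \<bullet> (op_app A w - g) - op_app A v \<bullet> (op_app A w' - g')
        = v \<bullet> (h - a *\<^sub>R w) - v \<bullet> (h' - a *\<^sub>R w')"
      using assms that by (simp add: normal_eq_def)
    then show ?thesis
      using assms by (simp add: normal_eq_def app_diff inner_diff_right algebra_simps)
  qed
  ultimately show ?thesis by (simp add: normal_eq_def)
qed

text \<open>Test the equation with \<open>v = w\<close>.\<close>

lemma normal_eq_energy:
  assumes "normal_eq a h g w"
  shows "a * (norm w)\<^sup>2 + (norm (op_app A w))\<^sup>2 = w \<bullet> h + op_app A w \<bullet> g"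
  using assms by (auto simp: normal_eq_def power2_norm_eq_inner inner_diff_right algebra_simps)

text \<open>For \<open>h = a x\<close> this says that \<open>B\<close> is a contraction.\<close>

lemma normal_eq_bound_rhs:
  assumes "normal_eq a h 0 w"
  shows "a * norm w \<le> norm h"
proof (cases "w = 0")
  case False
  have "a * (norm w)\<^sup>2 \<le> w \<bullet> h"
    using normal_eq_energy[OF assms] zero_le_power2[of "norm (op_app A w)"]
    unfolding inner_zero_right by linarith
  also have "\<dots> \<le> norm w * norm h" by (rule norm_cauchy_schwarz)
  finally have "norm w * (a * norm w) \<le> norm w * norm h" by (simp add: power2_eq_square algebra_simps)
  then show ?thesis using False by simp
qed simp

text \<open>This is the bound \<open>||S g|| \<le> ||g|| / sqrt a\<close>. The constant is not
  sharp, but any bound uniform in \<open>g\<close> gives uniqueness and the extension from the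
  domain of the adjoint to the whole space.\<close>

lemma normal_eq_bound_data:
  assumes "normal_eq a 0 g w"
  shows "a * (norm w)\<^sup>2 \<le> (norm g)\<^sup>2"
proof -
  have "a * (norm w)\<^sup>2 + (norm (op_app A w))\<^sup>2 \<le> norm (op_app A w) * norm g"
    using normal_eq_energy[OF assms] norm_cauchy_schwarz[of "op_app A w" g] by simp
  moreover have "0 \<le> (norm (op_app A w) - norm g)\<^sup>2 + (norm (op_app A w))\<^sup>2 + (norm g)\<^sup>2" by simp
  then have "norm (op_app A w) * norm g \<le> (norm (op_app A w))\<^sup>2 + (norm g)\<^sup>2"
    by (simp add: power2_diff)
  ultimately show ?thesis by linarith
qed

lemma normal_eq_unique:
  assumes "a > 0" "normal_eq a h g w" "normal_eq a h g w'"
  shows "w = w'"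
  using normal_eq_bound_data[of a 0 "w - w'"] normal_eq_diff[OF assms(2,3)] assms(1)
  by (simp add: mult_le_0_iff)

text \<open>
  The normal equation says that the residual of \<open>(h / \<surd>a, g)\<close> at the point \<open>(\<surd>a w, A w)\<close> of the
  rescaled graph of \<open>A\<close> is orthogonal to that graph.
\<close>

lemma normal_eq_exists:
  assumes "a > 0"
  obtains w where "normal_eq a h g w"
proof -
  define s where "s = sqrt a"
  have s: "s > 0" "s * s = a" using assms by (auto simp: s_def)
  let ?G = "(\<lambda>u. (s *\<^sub>R u, op_app A u)) ` op_dom A"
  \<comment> \<open>The rescaled graph is closed because it is the preimage of the graph under a
    continuous map.\<close>
  have "?G = (\<lambda>p. (inverse s *\<^sub>R fst p, snd p)) -` op_graph A"
  proof (intro set_eqI iffI)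
    fix p assume "p \<in> ?G"
    then show "p \<in> (\<lambda>p. (inverse s *\<^sub>R fst p, snd p)) -` op_graph A"
      using s by (auto simp: op_graph_def)
  next
    fix p assume "p \<in> (\<lambda>p. (inverse s *\<^sub>R fst p, snd p)) -` op_graph A"
    then have "inverse s *\<^sub>R fst p \<in> op_dom A" "snd p = op_app A (inverse s *\<^sub>R fst p)"
      by (auto simp: op_graph_def)
    then show "p \<in> ?G" using s by (intro image_eqI[of _ _ "inverse s *\<^sub>R fst p"]) (auto simp: prod_eq_iff)
  qed
  moreover have "closed ((\<lambda>p::'a \<times> 'a. (inverse s *\<^sub>R fst p, snd p)) -` op_graph A)"
    using cl unfolding closed_operator_def by (intro closed_vimage continuous_intros) auto
  ultimately have "closed ?G" by simp
  moreover have "subspace ?G"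
  proof (rule subspaceI)
    show "0 \<in> ?G" using subspace_0[OF subspace_dom]
      by (intro image_eqI[of _ _ 0]) (auto simp: app_zero prod_eq_iff)
    show "p + q \<in> ?G" if "p \<in> ?G" "q \<in> ?G" for p q
    proof -
      from that obtain u v where "u \<in> op_dom A" "v \<in> op_dom A"
        "p = (s *\<^sub>R u, op_app A u)" "q = (s *\<^sub>R v, op_app A v)" by auto
      then show ?thesis using subspace_add[OF subspace_dom]
        by (intro image_eqI[of _ _ "u + v"]) (auto simp: app_add algebra_simps)
    qed
    show "c *\<^sub>R p \<in> ?G" if "p \<in> ?G" for c p
    proof -
      from that obtain u where "u \<in> op_dom A" "p = (s *\<^sub>R u, op_app A u)" by auto
      then show ?thesis using subspace_scale[OF subspace_dom]
        by (intro image_eqI[of _ _ "c *\<^sub>R u"]) (auto simp: app_scale algebra_simps)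
    qed
  qed
  ultimately obtain p where p: "p \<in> ?G" "\<And>q. q \<in> ?G \<Longrightarrow> ((inverse s *\<^sub>R h, g) - p) \<bullet> q = 0"
    by (rule exists_orthogonal_projection[where x = "(inverse s *\<^sub>R h, g)"]) blast
  from p(1) obtain w where w: "w \<in> op_dom A" "p = (s *\<^sub>R w, op_app A w)" by auto
  have "op_app A v \<bullet> (op_app A w - g) = v \<bullet> (h - a *\<^sub>R w)" if "v \<in> op_dom A" for v
  proof -
    have "(inverse s *\<^sub>R h - s *\<^sub>R w) \<bullet> (s *\<^sub>R v) + (g - op_app A w) \<bullet> op_app A v = 0"
      using p(2)[OF imageI[OF that]] w(2) by (simp add: inner_prod_def)
    moreover have "(inverse s *\<^sub>R h - s *\<^sub>R w) \<bullet> (s *\<^sub>R v) = v \<bullet> (h - a *\<^sub>R w)"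
      using s(1) by (simp add: inner_diff_left inner_diff_right inner_commute algebra_simps flip: s(2))
    ultimately show ?thesis by (simp add: inner_diff_left inner_diff_right inner_commute algebra_simps)
  qed
  then show thesis using that w(1) by (auto simp: normal_eq_def)
qed

section \<open>Convergence of the homogeneous iteration\<close>

lemma normal_eq_iterates_tendsto_0:
  assumes a: "a > 0"
    and step: "\<And>n. normal_eq a (a *\<^sub>R e n) 0 (e (Suc n))"
    and orth: "\<And>v. v \<in> op_null A \<Longrightarrow> e 0 \<bullet> v = 0"
  shows "e \<longlonglongrightarrow> 0"
proof -
  have dom: "e (Suc n) \<in> op_dom A" for n using step by (simp add: normal_eq_def)
  have test: "op_app A v \<bullet> op_app A (e (Suc n)) = a * (v \<bullet> e n) - a * (v \<bullet> e (Suc n))"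
    if "v \<in> op_dom A" for v n
    using step[of n] that by (simp add: normal_eq_def inner_diff_right)
  \<comment> \<open>Selfadjointness of \<open>B\<close>: the equations for \<open>e (Suc m)\<close>
    and \<open>e (Suc n)\<close> are tested with each other's solution.\<close>
  have sym: "e (Suc m) \<bullet> e n = e m \<bullet> e (Suc n)" for m n
  proof -
    have "a * (e (Suc m) \<bullet> e n) = a * (e m \<bullet> e (Suc n))"
      using test[OF dom[of m], of n] test[OF dom[of n], of m] by (simp add: inner_commute)
    then show ?thesis using a by simp
  qed
  define c where "c k = e 0 \<bullet> e k" for k
  have c: "e m \<bullet> e n = c (m + n)" for m n
    by (induction m arbitrary: n) (simp_all add: c_def sym)
  have contr: "norm (e (Suc n)) \<le> norm (e n)" for n
    using normal_eq_bound_rhs[OF step[of n]] a by simp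
  \<comment> \<open>For \<open>k = 2j\<close>, \<open>c k = ||e j||^2\<close> and contractivity
    suffices, which is \<open>B^2 \<le> I\<close>. For \<open>k = 2j + 1\<close>, testing with
    \<open>e (Suc j)\<close> gives \<open>a (c k - c (Suc k)) = ||A (e (Suc j))||^2\<close>, which
    is \<open>B^2 \<le> B\<close>.\<close>
  have "c (Suc k) \<le> c k" for k
  proof (cases "even k")
    case True
    then obtain j where j: "k = j + j" by (auto elim!: evenE simp: mult_2)
    have "c (Suc k) \<le> norm (e j) * norm (e (Suc j))"
      using norm_cauchy_schwarz[of "e j" "e (Suc j)"] by (simp add: c j)
    also have "\<dots> \<le> norm (e j) * norm (e j)" using contr by (simp add: mult_left_mono)
    also have "\<dots> = c k" by (simp add: j flip: c) (simp add: power2_norm_eq_inner flip: power2_eq_square)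
    finally show ?thesis .
  next
    case False
    then obtain j where j: "k = j + Suc j" by (auto elim!: oddE simp: mult_2)
    have "a * c (Suc k) \<le> a * c k"
      using test[OF dom[of j], of j] inner_ge_zero[of "op_app A (e (Suc j))"] by (simp add: c j)
    then show ?thesis using a by simp
  qed
  then have dec: "decseq c" by (simp add: decseq_Suc_iff)
  have "0 \<le> c k" for k
  proof -
    \<comment> \<open>Terms of even index are squared norms, and \<open>c\<close> is
      decreasing.\<close>
    have "0 \<le> c (k + k)" by (simp flip: c)
    also have "\<dots> \<le> c k" using dec by (simp add: decseq_def)
    finally show ?thesis .
  qed
  then obtain L where L: "c \<longlonglongrightarrow> L" using decseq_convergent[OF dec] by metis
  have "Cauchy e"
  proof (rule metric_CauchyI)
    fix r :: real assume "0 < r"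
    \<comment> \<open>The expansion of \<open>||e m - e n||^2\<close> has coefficients 1, -2, 1: the
      limit \<open>L\<close> cancels and four errors below \<open>r^2 / 4\<close> remain.\<close>
    then have "0 < r\<^sup>2 / 4" by simp
    then obtain N where N: "\<And>n. n \<ge> N \<Longrightarrow> \<bar>c n - L\<bar> < r\<^sup>2 / 4"
      using LIMSEQ_D[OF L] unfolding real_norm_def by blast
    have "dist (e m) (e n) < r" if "m \<ge> N" "n \<ge> N" for m n
    proof -
      have "(norm (e m - e n))\<^sup>2 = c (m + m) - 2 * c (m + n) + c (n + n)"
        by (simp add: power2_norm_eq_inner inner_diff_left inner_diff_right c add.commute)
      also have "\<dots> < r\<^sup>2"
      proof -
        have "\<bar>c (m + m) - L\<bar> < r\<^sup>2 / 4" "\<bar>c (m + n) - L\<bar> < r\<^sup>2 / 4" "\<bar>c (n + n) - L\<bar> < r\<^sup>2 / 4"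
          using N that by simp_all
        then show ?thesis unfolding abs_less_iff by linarith
      qed
      finally show ?thesis using \<open>0 < r\<close> by (simp add: dist_norm power2_less_imp_less)
    qed
    then show "\<exists>N. \<forall>m\<ge>N. \<forall>n\<ge>N. dist (e m) (e n) < r" by blast
  qed
  then obtain z where z: "e \<longlonglongrightarrow> z" by (auto simp: Cauchy_convergent_iff convergent_def)
  \<comment> \<open>Here \<open>w = B z\<close>. As the equation is linear,
    \<open>e (Suc n) - w\<close> solves it for the data \<open>a (e n - z)\<close>, so contractivity
    gives \<open>e (Suc n)\<close> the limit \<open>w\<close>, whence
    \<open>B z = z\<close>.\<close>
  obtain w where w: "normal_eq a (a *\<^sub>R z) 0 w" using normal_eq_exists[OF a] by blast
  have "norm (e (Suc n) - w) \<le> norm (e n - z)" for n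
  proof -
    have "a * norm (e (Suc n) - w) \<le> norm (a *\<^sub>R e n - a *\<^sub>R z)"
      using normal_eq_diff[OF step w] by (intro normal_eq_bound_rhs) simp
    also have "\<dots> = a * norm (e n - z)" using a by (simp flip: scaleR_diff_right)
    finally show ?thesis using a by simp
  qed
  moreover have "(\<lambda>n. norm (e n - z)) \<longlonglongrightarrow> 0" by (rule tendsto_norm_zero[OF LIM_zero[OF z]])
  ultimately have "(\<lambda>n. e (Suc n) - w) \<longlonglongrightarrow> 0"
    by (rule Lim_null_comparison[OF always_eventually[OF allI]])
  then have "(\<lambda>n. e (Suc n)) \<longlonglongrightarrow> w" by (simp add: LIM_zero_iff)
  then have "w = z" using LIMSEQ_unique[OF _ LIMSEQ_Suc[OF z]] by blast
  \<comment> \<open>With \<open>w = z\<close> and \<open>h = a z\<close> the terms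
    \<open>a ||z||^2\<close> cancel in the energy identity, leaving
    \<open>||A z||^2 = 0\<close>.\<close>
  then have "z \<in> op_null A" using normal_eq_energy[OF w] w
    by (simp add: op_null_def normal_eq_def power2_norm_eq_inner)
  \<comment> \<open>Testing with \<open>v\<close> in the null space removes the left-hand side, so
    the iteration preserves the inner product with \<open>v\<close>.\<close>
  have "e n \<bullet> v = 0" if "v \<in> op_null A" for v n
  proof (induction n)
    case (Suc n)
    have "a * (v \<bullet> e n) = a * (v \<bullet> e (Suc n))" using test[of v n] that by (simp add: op_null_def)
    then show ?case using Suc a by (simp add: inner_commute)
  qed (use orth that in auto)
  then have "(\<lambda>n. e n \<bullet> z) \<longlonglongrightarrow> 0" using \<open>z \<in> op_null A\<close> by simp
  moreover have "(\<lambda>n. e n \<bullet> z) \<longlonglongrightarrow> z \<bullet> z" by (intro tendsto_intros z)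
  ultimately have "z \<bullet> z = 0" using LIMSEQ_unique by blast
  then show ?thesis using z by simp
qed

section \<open>The adjoint and the density of its domain\<close>

lemma adjoint_dom: "v \<in> op_dom (op_adjoint inner A) \<longleftrightarrow> (\<exists>w. \<forall>u\<in>op_dom A. op_app A u \<bullet> v = u \<bullet> w)"
  by (simp add: op_adjoint_def)

text \<open>Density of the domain of \<open>A\<close> makes \<open>w\<close> unique, so that the
  definite description in \<open>op_adjoint\<close> denotes it.\<close>

lemma adjoint_eqI:
  assumes "\<And>u. u \<in> op_dom A \<Longrightarrow> op_app A u \<bullet> v = u \<bullet> w"
  shows "v \<in> op_dom (op_adjoint inner A)" "op_app (op_adjoint inner A) v = w"
proof -
  show "v \<in> op_dom (op_adjoint inner A)" using assms by (auto simp: adjoint_dom)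
  have "w' = w" if "\<forall>u\<in>op_dom A. op_app A u \<bullet> v = u \<bullet> w'" for w'
    using orthogonal_dom_eq_0[of "w' - w"] that assms by (simp add: inner_diff_right)
  with assms show "op_app (op_adjoint inner A) v = w"
    unfolding op_adjoint_def operator.sel by (intro the_equality) auto
qed

lemma adjoint_app:
  assumes "v \<in> op_dom (op_adjoint inner A)" "u \<in> op_dom A"
  shows "op_app A u \<bullet> v = u \<bullet> op_app (op_adjoint inner A) v"
  using assms adjoint_eqI(2) by (metis adjoint_dom)

lemma subspace_adjoint_dom: "subspace (op_dom (op_adjoint inner A))"
proof (rule subspaceI)
  show "0 \<in> op_dom (op_adjoint inner A)" by (intro adjoint_eqI(1)[of _ 0]) simp
next
  fix v w assume "v \<in> op_dom (op_adjoint inner A)" "w \<in> op_dom (op_adjoint inner A)"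
  then show "v + w \<in> op_dom (op_adjoint inner A)"
    by (intro adjoint_eqI(1)[of _ "op_app (op_adjoint inner A) v + op_app (op_adjoint inner A) w"])
      (simp add: inner_add_right adjoint_app)
next
  fix v c assume "v \<in> op_dom (op_adjoint inner A)"
  then show "c *\<^sub>R v \<in> op_dom (op_adjoint inner A)"
    by (intro adjoint_eqI(1)[of _ "c *\<^sub>R op_app (op_adjoint inner A) v"]) (simp add: adjoint_app)
qed

text \<open>Let \<open>x\<close> be orthogonal to the domain of the adjoint, and project
  \<open>(0, x)\<close> onto the graph of \<open>A\<close>, i.e. solve the normal equation with
  \<open>a = 1\<close>, \<open>h = 0\<close>, \<open>g = x\<close>. The residual
  \<open>A w - x\<close> lies in that domain, with adjoint value \<open>- w\<close>, so it is
  orthogonal to \<open>x\<close>. The energy identity then forces \<open>w = 0\<close> and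
  \<open>A w = x\<close>, hence \<open>x = 0\<close>.\<close>

lemma adjoint_densely_defined: "closure (op_dom (op_adjoint inner A)) = UNIV"
proof (rule dense_subspace_if_orthogonal_trivial[OF subspace_adjoint_dom])
  fix x assume orth: "\<And>v. v \<in> op_dom (op_adjoint inner A) \<Longrightarrow> x \<bullet> v = 0"
  obtain w where w: "normal_eq 1 0 x w" using normal_eq_exists[of 1 0 x] by auto
  then have "op_app A w - x \<in> op_dom (op_adjoint inner A)"
    by (intro adjoint_eqI(1)[of _ "- w"]) (simp add: normal_eq_def)
  from orth[OF this] have x: "x \<bullet> x = op_app A w \<bullet> x"
    by (simp add: inner_diff_right inner_commute)
  have "(norm w)\<^sup>2 + (norm (op_app A w - x))\<^sup>2 = 0"
    using normal_eq_energy[OF w] x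
    by (simp add: power2_norm_eq_inner inner_diff_left inner_diff_right inner_commute)
  then have "w = 0" "op_app A w = x" by (auto simp: add_nonneg_eq_0_iff)
  then show "x = 0" using app_zero by simp
qed

section \<open>The inverse of \<open>Ta\<close> and the operator \<open>S\<close> as solution
  operators of the normal equation\<close>

context
  fixes a :: real and Ta :: "'a operator"
  assumes a: "a > 0"
    and Ta: "Ta = op_add (op_comp (op_adjoint inner A) A) (op_scaleR a op_id)"
begin

text \<open>The weak equation exhibits \<open>h - a w\<close> as the value of the adjoint at
  \<open>A w\<close>, so the domain condition of \<open>Ta\<close> comes for free.\<close>

lemma Ta_eq_iff: "w \<in> op_dom Ta \<and> op_app Ta w = h \<longleftrightarrow> normal_eq a h 0 w"
proof
  assume "w \<in> op_dom Ta \<and> op_app Ta w = h"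
  then have "w \<in> op_dom A" "op_app A w \<in> op_dom (op_adjoint inner A)"
    and "op_app (op_adjoint inner A) (op_app A w) + a *\<^sub>R w = h"
    by (auto simp: Ta op_add_def op_comp_def op_scaleR_def op_id_def)
  then show "normal_eq a h 0 w" by (auto simp: normal_eq_def adjoint_app)
next
  assume w: "normal_eq a h 0 w"
  then have "op_app A w \<in> op_dom (op_adjoint inner A)"
    "op_app (op_adjoint inner A) (op_app A w) = h - a *\<^sub>R w"
    by (auto intro!: adjoint_eqI simp: normal_eq_def)
  with w show "w \<in> op_dom Ta \<and> op_app Ta w = h"
    by (simp add: Ta op_add_def op_comp_def op_scaleR_def op_id_def normal_eq_def)
qed

text \<open>Uniqueness for the normal equation makes \<open>Ta\<close> injective, so
  \<open>op_inverse\<close> is meaningful.\<close>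

lemma inverse_Ta_eq:
  assumes "normal_eq a h 0 w"
  shows "op_app (op_inverse Ta) h = w"
proof -
  have "inj_on (op_app Ta) (op_dom Ta)"
    by (rule inj_onI) (metis Ta_eq_iff a normal_eq_unique)
  then show ?thesis
    unfolding op_inverse_def operator.sel using assms Ta_eq_iff by (intro inv_into_f_eq) auto
qed

lemma inverse_Ta_dom: "op_dom (op_inverse Ta) = UNIV"
proof -
  have "h \<in> op_range Ta" for h
    using normal_eq_exists[OF a, of h 0] Ta_eq_iff unfolding op_range_def by (metis image_eqI)
  then show ?thesis by (auto simp: op_inverse_def)
qed

text \<open>For \<open>g\<close> in the domain of the adjoint, the adjoint can be moved off
  \<open>g\<close> onto the test vector. The resulting equation makes sense, and is solvable, for
  every \<open>g\<close>.\<close>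

lemma graph_inverse_Ta_adjoint:
  "op_graph (op_comp (op_inverse Ta) (op_adjoint inner A)) =
     {(g, w). g \<in> op_dom (op_adjoint inner A) \<and> normal_eq a 0 g w}" (is "?G = ?N")
proof -
  have app: "op_app (op_inverse Ta) (op_app (op_adjoint inner A) g) = w"
    if "g \<in> op_dom (op_adjoint inner A)" "normal_eq a 0 g w" for g w
    using that by (intro inverse_Ta_eq) (auto simp: normal_eq_def inner_diff_right adjoint_app)
  have "?N \<subseteq> ?G"
    using app by (auto simp: op_graph_def op_comp_def inverse_Ta_dom)
  moreover have "(g, op_app (op_inverse Ta) (op_app (op_adjoint inner A) g)) \<in> ?N"
    if "g \<in> op_dom (op_adjoint inner A)" for g
  proof -
    obtain w where "normal_eq a 0 g w" using normal_eq_exists[OF a] by blast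
    then show ?thesis using app[OF that] that by simp
  qed
  then have "?G \<subseteq> ?N" by (auto simp: op_graph_def op_comp_def)
  ultimately show ?thesis by blast
qed

text \<open>The a priori bound in terms of \<open>g\<close> makes the solution depend continuously
  on \<open>g\<close>, and the domain of the adjoint is dense.\<close>

lemma closure_inverse_Ta_adjoint_eq:
  assumes w: "normal_eq a 0 g w"
  shows "op_app (op_closure (op_comp (op_inverse Ta) (op_adjoint inner A))) g = w"
proof -
  let ?G = "op_graph (op_comp (op_inverse Ta) (op_adjoint inner A))"
  \<comment> \<open>Used twice: for a sequence showing that \<open>(g, w)\<close> lies in the
    closure of the graph, and to show that no other \<open>(g, w')\<close> does.\<close>
  have lim: "X \<longlonglongrightarrow> w" if gr: "\<And>n. (G n, X n) \<in> ?G" and G: "G \<longlonglongrightarrow> g" for G X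
  proof -
    have "norm (X n - w) \<le> norm (G n - g) / sqrt a" for n
    proof -
      have "normal_eq a 0 (G n - g) (X n - w)"
        using normal_eq_diff[OF _ w, of 0 "G n" "X n"] gr[of n] by (simp add: graph_inverse_Ta_adjoint)
      then have "(sqrt a * norm (X n - w))\<^sup>2 \<le> (norm (G n - g))\<^sup>2"
        using normal_eq_bound_data a by (simp add: power_mult_distrib)
      then have "sqrt a * norm (X n - w) \<le> norm (G n - g)" by (rule power2_le_imp_le) simp
      then show ?thesis using a by (simp add: pos_le_divide_eq mult.commute)
    qed
    moreover have "(\<lambda>n. norm (G n - g) / sqrt a) \<longlonglongrightarrow> 0"
      using tendsto_divide_zero[OF tendsto_norm_zero[OF LIM_zero[OF G]]] .
    ultimately have "(\<lambda>n. X n - w) \<longlonglongrightarrow> 0"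
      by (rule Lim_null_comparison[OF always_eventually[OF allI]])
    then show ?thesis by (simp add: LIM_zero_iff)
  qed
  obtain G where G: "\<And>n. G n \<in> op_dom (op_adjoint inner A)" "G \<longlonglongrightarrow> g"
    using adjoint_densely_defined closure_sequential[of g] by (metis UNIV_I)
  have "\<exists>w. normal_eq a 0 (G n) w" for n using normal_eq_exists[OF a] by blast
  then obtain X where "\<And>n. normal_eq a 0 (G n) (X n)" by metis
  then have X: "(G n, X n) \<in> ?G" for n using G(1) by (simp add: graph_inverse_Ta_adjoint)
  have "(\<lambda>n. (G n, X n)) \<longlonglongrightarrow> (g, w)" using lim[OF X G(2)] G(2) by (rule tendsto_Pair[rotated])
  then have "(g, w) \<in> closure ?G"
    unfolding closure_sequential using X by (intro exI[of _ "\<lambda>n. (G n, X n)"]) simp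
  moreover have "w' = w" if "(g, w') \<in> closure ?G" for w'
  proof -
    from that obtain p where p: "\<forall>n. p n \<in> ?G" "p \<longlonglongrightarrow> (g, w')"
      unfolding closure_sequential by auto
    then have "(\<lambda>n. fst (p n)) \<longlonglongrightarrow> g" "(\<lambda>n. snd (p n)) \<longlonglongrightarrow> w'"
      using tendsto_fst[OF p(2)] tendsto_snd[OF p(2)] by auto
    moreover from this have "(\<lambda>n. snd (p n)) \<longlonglongrightarrow> w" using p(1) by (intro lim[of "\<lambda>n. fst (p n)"]) auto
    ultimately show ?thesis using LIMSEQ_unique by blast
  qed
  ultimately show ?thesis unfolding op_closure_def operator.sel by (intro the_equality)
qed

end

end

section \<open>Passing from the scalars \<open>'k\<close> to the reals\<close>

context hilbert_space
begin

lemma linear_operator_scaleR: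
  assumes "linear_operator smul A"
  shows "linear_operator scaleR A"
proof -
  have "subspace (op_dom A)" using assms unfolding linear_operator_def by auto
  then have "c *\<^sub>R x \<in> op_dom A" if "x \<in> op_dom A" for x c
    using that subspace_scale[of "op_dom A" x "of_real c"] by (simp add: scale_of_real)
  moreover have "op_app A (c *\<^sub>R x) = c *\<^sub>R op_app A x" if "x \<in> op_dom A" for x c
    using assms that unfolding linear_operator_def scale_of_real[symmetric] by blast
  ultimately show ?thesis
    using assms \<open>subspace (op_dom A)\<close>
    by (auto simp: linear_operator_def subspace_def real_vector.subspace_def simp flip: subspace_raw_def)
qed

text \<open>
  Only the real parts of the two sides are given to agree; apply this to \<open>smul (conj d) u\<close>, where \<open>d\<close> is
  the difference of the two sides at \<open>u\<close>.
\<close>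

lemma ip_eq_iff_inner_eq:
  assumes "linear_operator smul A"
  shows "(\<forall>u\<in>op_dom A. ip (op_app A u) v = ip u w) \<longleftrightarrow>
    (\<forall>u\<in>op_dom A. op_app A u \<bullet> v = u \<bullet> w)"
proof safe
  fix u assume *: "\<forall>u\<in>op_dom A. op_app A u \<bullet> v = u \<bullet> w" and u: "u \<in> op_dom A"
  define d where "d = ip (op_app A u) v - ip u w"
  have dom: "smul (conj d) u \<in> op_dom A" "op_app A (smul (conj d) u) = smul (conj d) (op_app A u)"
    using assms u unfolding linear_operator_def by (auto intro: subspace_scale)
  have add: "re_part (x + y) = re_part x + re_part y" for x y :: 'k
  proof -
    have "(of_real (2 * re_part (x + y)) :: 'k) = (x + y) + conj (x + y)"
      by (simp only: add_conj scaleR_conv_of_real mult_1_right)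
    also have "\<dots> = (x + conj x) + (y + conj y)" by (simp add: conj_add)
    also have "\<dots> = of_real (2 * re_part x + 2 * re_part y)"
      by (simp only: add_conj scaleR_conv_of_real mult_1_right of_real_add)
    finally have "(of_real (2 * re_part (x + y)) :: 'k) = of_real (2 * re_part x + 2 * re_part y)" .
    then show ?thesis unfolding of_real_eq_iff by simp
  qed
  have "re_part (ip (smul (conj d) (op_app A u)) v) = re_part (ip (smul (conj d) u) w)"
    unfolding re_part_ip using * dom by metis
  moreover have "ip (smul (conj d) (op_app A u)) v = d * conj d + ip (smul (conj d) u) w"
    by (simp add: ip_scale_left d_def algebra_simps)
  ultimately have "re_part (of_real ((norm d)\<^sup>2) :: 'k) = 0"
    by (simp add: add mult_conj scaleR_conv_of_real)
  then have "d = 0" by (simp only: re_part_of_real) simp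
  then show "ip (op_app A u) v = ip u w" by (simp add: d_def)
qed (metis re_part_ip)

text \<open>This transfers everything proved for the real adjoint to the adjoint with respect to
  \<open>ip\<close>.\<close>

lemma op_adjoint_eq_inner:
  "linear_operator smul A \<Longrightarrow> op_adjoint ip A = op_adjoint inner A"
  by (simp add: op_adjoint_def ip_eq_iff_inner_eq)

lemma orth_complD: "u \<in> orth_compl ip M \<Longrightarrow> v \<in> M \<Longrightarrow> u \<bullet> v = 0"
  by (auto simp: orth_compl_def re_part_zero simp flip: re_part_ip)

end

theorem theorem1:
  fixes smul :: "'k::rclike \<Rightarrow> 'a::{real_inner,complete_space} \<Rightarrow> 'a"
    and ip :: "'a \<Rightarrow> 'a \<Rightarrow> 'k"
    and A T Ta B S :: "'a operator"
    and f y :: 'a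
    and a :: real
    and u :: "nat \<Rightarrow> 'a"
  assumes "hilbert_space smul ip"
    and "linear_operator smul A"
    and "closed_operator A"
    and "densely_defined A"
    and "f \<in> op_range A"
    and "minimal_norm_solution A f y"
    and "a > 0"
    and "T = op_comp (op_adjoint ip A) A"
    and "Ta = op_add T (op_scaleR a op_id)"
    and "B = op_scaleR a (op_inverse Ta)"
    and "S = op_closure (op_comp (op_inverse Ta) (op_adjoint ip A))"
    and "u 1 \<in> orth_compl ip (op_null A)"
    and "\<And>n. n \<ge> 1 \<Longrightarrow> u (n + 1) = op_app B (u n) + op_app S f"
  shows "(\<lambda>n. norm (u n - y)) \<longlonglongrightarrow> 0"
proof -
  interpret H: hilbert_space smul ip by fact
  interpret closed_dense_operator A
    using assms(2-4) H.linear_operator_scaleR by unfold_locales auto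
  have adj: "op_adjoint ip A = op_adjoint inner A" using assms(2) by (rule H.op_adjoint_eq_inner)
  have Ta: "Ta = op_add (op_comp (op_adjoint inner A) A) (op_scaleR a op_id)"
    using assms(8,9) by (simp add: adj)
  have y: "y \<in> op_dom A" "op_app A y = f" "y \<in> orth_compl ip (op_null A)"
    using assms(6) minimal_norm_solution_iff[OF assms(1,2)] by auto
  have B: "normal_eq a (a *\<^sub>R x) 0 (op_app B x)" for x
  proof -
    obtain w where w: "normal_eq a x 0 w" using normal_eq_exists[OF assms(7)] by blast
    then have "op_app B x = a *\<^sub>R w"
      using inverse_Ta_eq[OF assms(7) Ta w] assms(10) by (simp add: op_scaleR_def)
    moreover have "normal_eq a (a *\<^sub>R x) 0 (a *\<^sub>R w)"
      using w subspace_scale[OF subspace_dom]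
      by (simp add: normal_eq_def app_scale flip: scaleR_diff_right)
        (simp add: scaleR_diff_right inner_diff_right algebra_simps)
    ultimately show ?thesis by simp
  qed
  \<comment> \<open>Since \<open>A y = f\<close>, the residual \<open>A (y - B y) - f\<close> is
    \<open>- A (B y)\<close>, so this is the equation for \<open>B y\<close> with the sign
    reversed.\<close>
  have "normal_eq a 0 f (y - op_app B y)"
    using B[of y] y subspace_diff[OF subspace_dom]
    by (auto simp: normal_eq_def app_diff inner_diff_right algebra_simps)
  then have S: "op_app S f = y - op_app B y"
    using closure_inverse_Ta_adjoint_eq[OF assms(7) Ta] assms(11) by (simp add: adj)
  \<comment> \<open>The shift makes \<open>e 0 = u 1 - y\<close>, the first error to which the
    recursion applies; both \<open>u 1\<close> and \<open>y\<close> are orthogonal to the null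
    space.\<close>
  define e where "e n = u (Suc n) - y" for n
  have "normal_eq a (a *\<^sub>R e n) 0 (e (Suc n))" for n
    using normal_eq_diff[OF B[of "u (Suc n)"] B[of y]] assms(13)[of "Suc n"]
    by (simp add: e_def S scaleR_diff_right)
  moreover have "e 0 \<bullet> v = 0" if "v \<in> op_null A" for v
    using H.orth_complD[OF assms(12) that] H.orth_complD[OF y(3) that]
    by (simp add: e_def inner_diff_left)
  ultimately have "e \<longlonglongrightarrow> 0" by (rule normal_eq_iterates_tendsto_0[OF assms(7)])
  then have "(\<lambda>n. norm (u (Suc n) - y)) \<longlonglongrightarrow> 0" unfolding e_def by (rule tendsto_norm_zero)
  then show ?thesis by (rule LIMSEQ_imp_Suc)
qed

end
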